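(* Let $V$ be a finite set, let $f\colon 2^V\to\mathbb{R}$ be a submodular function, let $k\in\mathbb{R}$, and let $\mathcal{X}=\{X\in 2^V\mid f(X)<k\}$. Then $\mathcal{X}$ can be unravelled; that is, there is a sequence $\mathcal{X}=\mathcal{X}_n\supseteq\dots\supseteq\mathcal{X}_0=\emptyset$ of woven sets such that $|\mathcal{X}_i\setminus\mathcal{X}_{i-1}|=1$ for all $1\le i\le n$.
   Context: A function $f\colon 2^V\to\mathbb{R}$ is submodular if $f(X)+f(Y)\ge f(X\cup Y)+f(X\cap Y)$ for all $X,Y\in 2^V$. A finite set $\mathcal{Y}$ of finite sets is woven if for all $X,Y\in\mathcal{Y}$ at least one of $X\cup Y$ and $X\cap Y$ is in $\mathcal{Y}$ (so the empty family is woven). *)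

theory Defs
  imports Complex_Main
begin

(* A function on the power set of V is a total function on 'a set; only its values on subsets
   of V matter. *)
definition submodular_on :: "'a set \<Rightarrow> ('a set \<Rightarrow> real) \<Rightarrow> bool" where
  "submodular_on V f \<longleftrightarrow>
     (\<forall>X\<in>Pow V. \<forall>Y\<in>Pow V. f X + f Y \<ge> f (X \<union> Y) + f (X \<inter> Y))"

definition woven :: "'a set set \<Rightarrow> bool" where
  "woven \<Y> \<longleftrightarrow> finite \<Y> \<and> (\<forall>X\<in>\<Y>. finite X) \<and>
     (\<forall>X\<in>\<Y>. \<forall>Y\<in>\<Y>. X \<union> Y \<in> \<Y> \<or> X \<inter> Y \<in> \<Y>)"

(* Only the members F 0, ..., F n of the sequence F matter. *)
definition unravels :: "nat \<Rightarrow> (nat \<Rightarrow> 'a set set) \<Rightarrow> 'a set set \<Rightarrow> bool" where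
  "unravels n F \<X> \<longleftrightarrow> F n = \<X> \<and> F 0 = {} \<and>
     (\<forall>i\<in>{0..n}. woven (F i)) \<and>
     (\<forall>i\<in>{1..n}. F (i - 1) \<subseteq> F i \<and> card (F i - F (i - 1)) = 1)"

definition can_be_unravelled :: "'a set set \<Rightarrow> bool" where
  "can_be_unravelled \<X> \<longleftrightarrow> (\<exists>n F. unravels n F \<X>)"

end

theory Submission
  imports Defs
begin

text \<open>
  The idea is to peel off one set at a time, always one of largest value under \<open>f\<close>, and to
  break ties between sets of equal value by inclusion, so that larger sets go first. Every
  family that occurs in this process is an initial segment of \<open>2\<^sup>V\<close>, in the sense of
  \<open>initial_segment\<close> below.

  Initial segments are woven for the following reason. Let \<open>f Y \<le> f X\<close>. Either
  \<open>f (X \<inter> Y) \<le> f X\<close>, and then \<open>X \<inter> Y\<close> precedes \<open>X\<close>, a tie being decided by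
  \<open>X \<inter> Y \<subseteq> X\<close>; or \<open>f (X \<inter> Y) > f X\<close>, and then submodularity forces
  \<open>f (X \<union> Y) < f Y\<close>. This is \<open>initial_segment_woven\<close>. Since the sublevel sets
  of \<open>f\<close> are initial segments and removing a last element preserves the property
  (\<open>initial_segment_remove_last\<close>), induction on the family gives the sequence.
\<close>

text \<open>
  The condition on \<open>Z\<close> says that \<open>Z\<close> comes strictly before \<open>X\<close> or equals it. With only
  \<open>f Z < f X\<close> in its place, such a family need not be woven: for constant \<open>f\<close>, every family of
  subsets of \<open>V\<close> would qualify.
\<close>

definition initial_segment :: "'a set \<Rightarrow> ('a set \<Rightarrow> real) \<Rightarrow> 'a set set \<Rightarrow> bool" where
  "initial_segment V f \<Y> \<longleftrightarrow> \<Y> \<subseteq> Pow V \<and>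
     (\<forall>X\<in>\<Y>. \<forall>Z\<in>Pow V. f Z < f X \<or> f Z = f X \<and> Z \<subseteq> X \<longrightarrow> Z \<in> \<Y>)"

lemma initial_segment_sublevel: "initial_segment V f {X \<in> Pow V. f X < k}"
  unfolding initial_segment_def by auto

lemma initial_segment_woven:
  assumes V: "finite V" and f: "submodular_on V f" and \<Y>: "initial_segment V f \<Y>"
  shows "woven \<Y>"
proof -
  have sub: "\<Y> \<subseteq> Pow V"
    using \<Y> unfolding initial_segment_def by blast
  have closed: "Z \<in> \<Y>" if "X \<in> \<Y>" "Z \<subseteq> V" "f Z < f X \<or> f Z = f X \<and> Z \<subseteq> X" for X Z
    using \<Y> that unfolding initial_segment_def by blast
  have ordered: "X \<union> Y \<in> \<Y> \<or> X \<inter> Y \<in> \<Y>" if "X \<in> \<Y>" "Y \<in> \<Y>" "f Y \<le> f X" for X Y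
  proof (cases "f (X \<inter> Y) \<le> f X")
    case True
    then have "f (X \<inter> Y) < f X \<or> f (X \<inter> Y) = f X \<and> X \<inter> Y \<subseteq> X" by auto
    moreover have "X \<inter> Y \<subseteq> V" using that sub by blast
    ultimately have "X \<inter> Y \<in> \<Y>" using closed \<open>X \<in> \<Y>\<close> by blast
    then show ?thesis ..
  next
    case False
    have "f X + f Y \<ge> f (X \<union> Y) + f (X \<inter> Y)"
      using f that sub unfolding submodular_on_def by blast
    with False have "f (X \<union> Y) < f Y" by linarith
    moreover have "X \<union> Y \<subseteq> V" using that sub by blast
    ultimately have "X \<union> Y \<in> \<Y>" using closed \<open>Y \<in> \<Y>\<close> by blast
    then show ?thesis ..
  qed
  have "X \<union> Y \<in> \<Y> \<or> X \<inter> Y \<in> \<Y>" if "X \<in> \<Y>" "Y \<in> \<Y>" for X Y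
    using ordered[of X Y] ordered[of Y X] that linorder_le_cases[of "f X" "f Y"]
    by (metis Un_commute Int_commute)
  moreover have "finite \<Y>" using sub finite_Pow_iff[THEN iffD2, OF V] by (rule finite_subset)
  moreover have "\<forall>X\<in>\<Y>. finite X" using V sub by (blast intro: finite_subset)
  ultimately show ?thesis unfolding woven_def by blast
qed

text \<open>
  The set to remove is a last one: an inclusion-maximal set among those of largest value. No
  other member comes after it, so no other member requires its presence.
\<close>

lemma initial_segment_remove_last:
  assumes "finite \<Y>" and "\<Y> \<noteq> {}" and \<Y>: "initial_segment V f \<Y>"
  obtains X where "X \<in> \<Y>" and "initial_segment V f (\<Y> - {X})"
proof -
  define M where "M = Max (f ` \<Y>)"
  have le_M: "f Y \<le> M" if "Y \<in> \<Y>" for Y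
    using assms that by (simp add: M_def)
  have "M \<in> f ` \<Y>" unfolding M_def using assms by (intro Max_in) auto
  then have "{Y \<in> \<Y>. f Y = M} \<noteq> {}" by auto
  moreover have "finite {Y \<in> \<Y>. f Y = M}" using assms(1) by simp
  ultimately obtain X where "X \<in> {Y \<in> \<Y>. f Y = M}"
    and "\<forall>Y \<in> {Y \<in> \<Y>. f Y = M}. X \<subseteq> Y \<longrightarrow> X = Y"
    using finite_has_maximal by meson
  then have X: "X \<in> \<Y>" "f X = M"
    and maximal: "\<And>Y. Y \<in> \<Y> \<Longrightarrow> f Y = M \<Longrightarrow> X \<subseteq> Y \<Longrightarrow> X = Y"
    by blast+
  have "initial_segment V f (\<Y> - {X})"
    unfolding initial_segment_def
  proof (intro conjI ballI impI)
    show "\<Y> - {X} \<subseteq> Pow V" using \<Y> unfolding initial_segment_def by blast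
  next
    fix Y Z
    assume Y: "Y \<in> \<Y> - {X}" and Z: "Z \<in> Pow V" and before: "f Z < f Y \<or> f Z = f Y \<and> Z \<subseteq> Y"
    have "Z \<in> \<Y>" using \<Y> Y Z before unfolding initial_segment_def by blast
    moreover have "Z \<noteq> X" using before le_M[of Y] maximal[of Y] X Y by force
    ultimately show "Z \<in> \<Y> - {X}" by simp
  qed
  with X(1) show thesis by (rule that)
qed

lemma can_be_unravelled_empty: "can_be_unravelled {}"
proof -
  have "unravels 0 (\<lambda>_. {}) {}" by (simp add: unravels_def woven_def)
  then show ?thesis unfolding can_be_unravelled_def by blast
qed

lemma can_be_unravelled_step:
  assumes "woven \<Y>" and X: "X \<in> \<Y>" and "can_be_unravelled (\<Y> - {X})"
  shows "can_be_unravelled \<Y>"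
proof -
  obtain n F where F: "unravels n F (\<Y> - {X})"
    using assms(3) unfolding can_be_unravelled_def by blast
  let ?G = "F(Suc n := \<Y>)"
  have "unravels (Suc n) ?G \<Y>"
    unfolding unravels_def
  proof (intro conjI ballI)
    show "?G (Suc n) = \<Y>" by simp
    show "?G 0 = {}" using F by (simp add: unravels_def)
  next
    fix i assume "i \<in> {0..Suc n}"
    then show "woven (?G i)" using F \<open>woven \<Y>\<close> by (simp add: unravels_def)
  next
    fix i assume i: "i \<in> {1..Suc n}"
    have "?G (i - 1) \<subseteq> ?G i \<and> card (?G i - ?G (i - 1)) = 1"
    proof (cases "i = Suc n")
      case True
      have "F n = \<Y> - {X}" using F by (simp add: unravels_def)
      moreover have "\<Y> - (\<Y> - {X}) = {X}" using X by blast
      ultimately show ?thesis using True by auto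
    next
      case False
      with i have "i \<in> {1..n}" "i - 1 \<noteq> Suc n" by auto
      with False F show ?thesis unfolding unravels_def by simp
    qed
    then show "?G (i - 1) \<subseteq> ?G i" and "card (?G i - ?G (i - 1)) = 1" by blast+
  qed
  then show ?thesis unfolding can_be_unravelled_def by blast
qed

lemma initial_segment_can_be_unravelled:
  assumes V: "finite V" and f: "submodular_on V f" and "initial_segment V f \<Y>"
  shows "can_be_unravelled \<Y>"
proof -
  have "finite \<Y>"
    using initial_segment_woven[OF assms] unfolding woven_def by blast
  then show ?thesis using \<open>initial_segment V f \<Y>\<close>
  proof (induction \<Y> rule: finite_psubset_induct)
    case (psubset \<Y>)
    show ?case
    proof (cases "\<Y> = {}")
      case True
      then show ?thesis by (simp add: can_be_unravelled_empty)
    next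
      case False
      then obtain X where X: "X \<in> \<Y>" "initial_segment V f (\<Y> - {X})"
        using initial_segment_remove_last psubset by metis
      then have "can_be_unravelled (\<Y> - {X})" using psubset.IH by blast
      with initial_segment_woven[OF V f psubset.prems] X(1) show ?thesis
        by (rule can_be_unravelled_step)
    qed
  qed
qed

theorem theorem2:
  fixes V :: "'a set" and f :: "'a set \<Rightarrow> real" and k :: real
  assumes "finite V"
    and "submodular_on V f"
  shows "can_be_unravelled {X \<in> Pow V. f X < k}"
  using assms initial_segment_sublevel by (rule initial_segment_can_be_unravelled)

end
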